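(* Let $K,F,Q,S$ be positive integers with $Q<F$. There exists a $(K,F,Q,S)$ placement delivery array (PDA) if and only if there exist three binary (i.e. $\{0,1\}$-valued) matrices $\mathbf{C}_{X,Y}$, $\mathbf{C}_{X,Z}$ and $\mathbf{C}_{Y,Z}$, where $X$ is a set with $|X|=F$, $Y$ is a set with $|Y|=S$, and $Z$ is a set with $|Z|=K$, such that the following conditions hold: (E1) For every $z\in Z$, $|\{x\in X:\mathbf{C}_{X,Z}(x,z)=1\}|=|X|-Q$. (E2) For every $y\in Y$, $\{z\in Z:\mathbf{C}_{Y,Z}(y,z)=1\}\neq\emptyset$. (E3) For every $(x,y)\in X\times Y$ such that $\mathbf{C}_{X,Y}(x,y)=1$, there is exactly one $z\in Z$ such that $\mathbf{C}_{X,Z}(x,z)=\mathbf{C}_{Y,Z}(y,z)=1$. (E4) For every $(x,z)\in X\times Z$ such that $\mathbf{C}_{X,Z}(x,z)=1$, there is exactly one $y\in Y$ such that $\mathbf{C}_{X,Y}(x,y)=\mathbf{C}_{Y,Z}(y,z)=1$. (E5) For every $(y,z)\in Y\times Z$ such that $\mathbf{C}_{Y,Z}(y,z)=1$, there is exactly one $x\in X$ such that $\mathbf{C}_{X,Y}(x,y)=\mathbf{C}_{X,Z}(x,z)=1$.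
   Context: Notation: $[n]=\{1,\dots,n\}$. For sets $A,B$ (not necessarily distinct), $\mathbf{C}_{A,B}$ denotes a matrix with rows indexed by $A$ and columns indexed by $B$; its entry in row $a$, column $b$ is $\mathbf{C}_{A,B}(a,b)$. Matrices with different subscripts are different matrices, even if the index sets coincide as sets. Placement delivery array: let $K,F,Q,S$ be positive integers with $Q<F$. An $F\times K$ array $\mathbf{P}=[p_{j,k}]$ with entries in $[S]\cup\{*\}$ is a $(K,F,Q,S)$ PDA if: (C1) the symbol $*$ appears exactly $Q$ times in each column; (C2) each integer $s\in[S]$ occurs at least once in the array; (C3) for any two distinct pairs $(j_1,k_1),(j_2,k_2)\in[F]\times[K]$, if $p_{j_1,k_1}=p_{j_2,k_2}=s\in[S]$, then $j_1\neq j_2$, $k_1\neq k_2$ and $p_{j_1,k_2}=p_{j_2,k_1}=*$. *)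

theory Defs
  imports Main
begin

text \<open>
  An array with rows \<open>1..F\<close> and columns \<open>1..K\<close> is a function \<open>P j k\<close> (row first);
  \<open>None\<close> stands for the symbol \<open>*\<close>. Values outside the index range are irrelevant.
\<close>

definition is_PDA :: "nat \<Rightarrow> nat \<Rightarrow> nat \<Rightarrow> nat \<Rightarrow> (nat \<Rightarrow> nat \<Rightarrow> nat option) \<Rightarrow> bool" where
  "is_PDA K F Q S P \<longleftrightarrow>
     (\<forall>j\<in>{1..F}. \<forall>k\<in>{1..K}. P j k \<in> Some ` {1..S} \<union> {None}) \<and>
     (\<forall>k\<in>{1..K}. card {j\<in>{1..F}. P j k = None} = Q) \<and>
     (\<forall>s\<in>{1..S}. \<exists>j\<in>{1..F}. \<exists>k\<in>{1..K}. P j k = Some s) \<and>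
     (\<forall>j1\<in>{1..F}. \<forall>k1\<in>{1..K}. \<forall>j2\<in>{1..F}. \<forall>k2\<in>{1..K}. \<forall>s\<in>{1..S}.
        (j1, k1) \<noteq> (j2, k2) \<longrightarrow> P j1 k1 = Some s \<longrightarrow> P j2 k2 = Some s \<longrightarrow>
        j1 \<noteq> j2 \<and> k1 \<noteq> k2 \<and> P j1 k2 = None \<and> P j2 k1 = None)"

definition binary_matrix :: "'a set \<Rightarrow> 'b set \<Rightarrow> ('a \<Rightarrow> 'b \<Rightarrow> nat) \<Rightarrow> bool" where
  "binary_matrix A B C \<longleftrightarrow> (\<forall>a\<in>A. \<forall>b\<in>B. C a b \<in> {0, 1})"

end

theory Submission
  imports Defs
begin

text \<open>
  Let \<open>CXZ\<close> mark the cells of the array that hold an integer, and let \<open>CXY\<close> and \<open>CYZ\<close> record which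
  integers occur in which row and in which column. If integer \<open>y\<close> occurs in row \<open>x\<close> and in column
  \<open>z\<close>, then (C3) forces the cell \<open>(x, z)\<close> to be \<open>*\<close> unless it holds \<open>y\<close> itself; this is what the
  uniqueness parts of (E3)--(E5) say. Conversely (E4) defines the entry of each marked cell, and the
  uniqueness in (E3) and (E5) gives (C3) back.
\<close>

text \<open>Bundles the binarity conditions with (E1)--(E5) so that both directions can pass them as
  one fact. The conjuncts follow the wording of the theorem literally, so unfolding alone recovers
  its statement.\<close>

definition pda_matrices ::
    "'x set \<Rightarrow> 'y set \<Rightarrow> 'z set \<Rightarrow> nat \<Rightarrow> ('x \<Rightarrow> 'y \<Rightarrow> nat) \<Rightarrow> ('x \<Rightarrow> 'z \<Rightarrow> nat) \<Rightarrow> ('y \<Rightarrow> 'z \<Rightarrow> nat) \<Rightarrow> bool" where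
  "pda_matrices X Y Z Q CXY CXZ CYZ \<longleftrightarrow>
     binary_matrix X Y CXY \<and> binary_matrix X Z CXZ \<and> binary_matrix Y Z CYZ \<and>
     (\<forall>z\<in>Z. card {x\<in>X. CXZ x z = 1} = card X - Q) \<and>
     (\<forall>y\<in>Y. {z\<in>Z. CYZ y z = 1} \<noteq> {}) \<and>
     (\<forall>x\<in>X. \<forall>y\<in>Y. CXY x y = 1 \<longrightarrow> (\<exists>!z. z \<in> Z \<and> CXZ x z = 1 \<and> CYZ y z = 1)) \<and>
     (\<forall>x\<in>X. \<forall>z\<in>Z. CXZ x z = 1 \<longrightarrow> (\<exists>!y. y \<in> Y \<and> CXY x y = 1 \<and> CYZ y z = 1)) \<and>
     (\<forall>y\<in>Y. \<forall>z\<in>Z. CYZ y z = 1 \<longrightarrow> (\<exists>!x. x \<in> X \<and> CXY x y = 1 \<and> CXZ x z = 1))"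

lemma card_Collect_complement:
  assumes "finite A"
  shows "card {x\<in>A. \<not> R x} = card A - card {x\<in>A. R x}"
proof -
  have "{x\<in>A. \<not> R x} = A - {x\<in>A. R x}" by auto
  then show ?thesis using assms by (simp add: card_Diff_subset)
qed

lemma card_Collect_bij_betw:
  assumes "bij_betw f A B"
  shows "card {x\<in>A. R (f x)} = card {y\<in>B. R y}"
proof (rule bij_betw_same_card)
  show "bij_betw f {x\<in>A. R (f x)} {y\<in>B. R y}"
    using assms by (auto simp: bij_betw_def inj_on_def)
qed

text \<open>The bijections only relabel rows, integers and columns, so that the index sets may have
  any type. (E1) is a complementary count of stars, and the uniqueness claims all come from one
  consequence of (C3), the local fact \<open>C3\<close>.\<close>

lemma is_PDA_imp_pda_matrices:
  assumes PDA: "is_PDA K F Q S P"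
    and f: "bij_betw f X {1..F}" and g: "bij_betw g Y {1..S}" and h: "bij_betw h Z {1..K}"
  shows "pda_matrices X Y Z Q
    (\<lambda>x y. of_bool (\<exists>z\<in>Z. P (f x) (h z) = Some (g y)))
    (\<lambda>x z. of_bool (P (f x) (h z) \<noteq> None))
    (\<lambda>y z. of_bool (\<exists>x\<in>X. P (f x) (h z) = Some (g y)))"
proof -
  define A where "A x z = P (f x) (h z)" for x z
  have fin: "finite X" using f bij_betw_finite by blast
  have fX: "f x \<in> {1..F}" if "x \<in> X" for x using bij_betwE[OF f] that by blast
  have gY: "g y \<in> {1..S}" if "y \<in> Y" for y using bij_betwE[OF g] that by blast
  have hZ: "h z \<in> {1..K}" if "z \<in> Z" for z using bij_betwE[OF h] that by blast
  have gi: "g y = g y' \<longleftrightarrow> y = y'" if "y \<in> Y" "y' \<in> Y" for y y'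
    using bij_betw_imp_inj_on[OF g] that by (auto dest: inj_onD)
  have C0: "\<exists>y\<in>Y. A x z = Some (g y)" if "x \<in> X" "z \<in> Z" "A x z \<noteq> None" for x z
  proof -
    have "A x z \<in> Some ` {1..S} \<union> {None}"
      using PDA fX[OF that(1)] hZ[OF that(2)] unfolding is_PDA_def A_def by blast
    then have "A x z \<in> Some ` g ` Y" using that(3) bij_betw_imp_surj_on[OF g] by auto
    then show ?thesis by blast
  qed
  have C1: "card {x\<in>X. A x z \<noteq> None} = card X - Q" if "z \<in> Z" for z
  proof -
    have "card {x\<in>X. A x z = None} = card {j\<in>{1..F}. P j (h z) = None}"
      unfolding A_def by (rule card_Collect_bij_betw[OF f])
    also have "\<dots> = Q" using PDA hZ[OF that] unfolding is_PDA_def by blast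
    finally show ?thesis by (simp only: card_Collect_complement[OF fin])
  qed
  have C2: "\<exists>x\<in>X. \<exists>z\<in>Z. A x z = Some (g y)" if y: "y \<in> Y" for y
  proof -
    obtain j k where "j \<in> {1..F}" "k \<in> {1..K}" "P j k = Some (g y)"
      using PDA gY[OF y] unfolding is_PDA_def by blast
    then show ?thesis
      unfolding A_def using bij_betw_imp_surj_on[OF f] bij_betw_imp_surj_on[OF h]
      by (metis imageE)
  qed
  \<comment> \<open>Contrapositive of (C3) after relabelling: if one of the two cells crossing two
    occurrences of an integer is not a star, the occurrences coincide.\<close>
  have C3: "x = x' \<and> z = z'"
    if "x \<in> X" "x' \<in> X" "z \<in> Z" "z' \<in> Z" "y \<in> Y"
      "A x z = Some (g y)" "A x' z' = Some (g y)" "A x z' \<noteq> None" for x x' y z z'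
  proof -
    note PDA3 = PDA[unfolded is_PDA_def, THEN conjunct2, THEN conjunct2, THEN conjunct2, rule_format,
        OF fX[OF that(1)] hZ[OF that(3)] fX[OF that(2)] hZ[OF that(4)] gY[OF that(5)]
        _ that(6,7)[unfolded A_def]]
    have "(f x, h z) = (f x', h z')"
    proof (rule ccontr)
      assume "(f x, h z) \<noteq> (f x', h z')"
      from PDA3[OF this] that(8) show False by (simp add: A_def)
    qed
    then show ?thesis
      using bij_betw_imp_inj_on[OF f] bij_betw_imp_inj_on[OF h] that(1-4) by (auto dest: inj_onD)
  qed
  have E3: "\<exists>!z. z \<in> Z \<and> A x z \<noteq> None \<and> (\<exists>x\<in>X. A x z = Some (g y))"
    if "x \<in> X" "y \<in> Y" and ex: "\<exists>z\<in>Z. A x z = Some (g y)" for x y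
  proof -
    obtain z where "z \<in> Z" "A x z = Some (g y)" using ex by blast
    \<comment> \<open>A rival column contains \<open>y\<close> in some row and has an integer in row
      \<open>x\<close>. That integer sits in a crossing cell of this occurrence and
      \<open>(x, z)\<close>, so \<open>C3\<close> identifies the columns.\<close>
    then show ?thesis
      using that(1,2) by (intro ex1I[of _ z]) (auto dest: C3[of x _ z _ y])
  qed
  have E4: "\<exists>!y. y \<in> Y \<and> (\<exists>z\<in>Z. A x z = Some (g y)) \<and> (\<exists>x\<in>X. A x z = Some (g y))"
    if xz: "x \<in> X" "z \<in> Z" "A x z \<noteq> None" for x z
  proof -
    obtain y where y: "y \<in> Y" "A x z = Some (g y)" using C0[OF xz] by blast
    show ?thesis
    proof (rule ex1I[of _ y])
      fix y' assume y': "y' \<in> Y \<and> (\<exists>z\<in>Z. A x z = Some (g y')) \<and> (\<exists>x\<in>X. A x z = Some (g y'))"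
      then obtain x' z' where "x' \<in> X" "z' \<in> Z" "A x z' = Some (g y')" "A x' z = Some (g y')"
        by blast
      \<comment> \<open>The cell \<open>(x, z)\<close> crosses the occurrences of \<open>y'\<close>
        at \<open>(x, z')\<close> and \<open>(x', z)\<close>; not being a star, it must be that
        occurrence itself.\<close>
      then have "A x z = Some (g y')" using C3[of x x' z' z y'] y' xz by blast
      then show "y' = y" using y y' gi by auto
    qed (use xz y in blast)
  qed
  have E5: "\<exists>!x. x \<in> X \<and> (\<exists>z\<in>Z. A x z = Some (g y)) \<and> A x z \<noteq> None"
    if "y \<in> Y" "z \<in> Z" and ex: "\<exists>x\<in>X. A x z = Some (g y)" for y z
  proof -
    obtain x where "x \<in> X" "A x z = Some (g y)" using ex by blast
    \<comment> \<open>Here the crossing cell lies in the rival row and in column \<open>z\<close>,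
      so the rival occurrence comes first in \<open>C3\<close>.\<close>
    then show ?thesis
      using that(1,2) by (intro ex1I[of _ x]) (auto dest: C3[of _ x _ z y])
  qed
  have E2: "{z\<in>Z. \<exists>x\<in>X. A x z = Some (g y)} \<noteq> {}" if "y \<in> Y" for y
    using C2[OF that] by blast
  show ?thesis
    unfolding pda_matrices_def binary_matrix_def A_def[symmetric] of_bool_eq_1_iff
    using C1 E2 E3 E4 E5 by (intro conjI) (simp | blast)+
qed

text \<open>The description operator is well defined on each marked cell because (E4) provides
  exactly one integer there. After (E3)--(E5) are carried over to numeric indices, the array
  conditions can be read off.\<close>

lemma pda_matrices_imp_is_PDA:
  assumes M: "pda_matrices X Y Z Q CXY CXZ CYZ" and "Q \<le> F"
    and f: "bij_betw f {1..F} X" and g: "bij_betw g {1..S} Y" and h: "bij_betw h {1..K} Z"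
  shows "is_PDA K F Q S (\<lambda>j k. if CXZ (f j) (h k) = 1
    then Some (THE s. s \<in> {1..S} \<and> CXY (f j) (g s) = 1 \<and> CYZ (g s) (h k) = 1) else None)"
    (is "is_PDA K F Q S ?P")
proof -
  have fX: "f j \<in> X" if "j \<in> {1..F}" for j using bij_betwE[OF f] that by blast
  have gY: "g s \<in> Y" if "s \<in> {1..S}" for s using bij_betwE[OF g] that by blast
  have hZ: "h k \<in> Z" if "k \<in> {1..K}" for k using bij_betwE[OF h] that by blast
  have E3: "k = k'" if "j \<in> {1..F}" "s \<in> {1..S}" "k \<in> {1..K}" "k' \<in> {1..K}" "CXY (f j) (g s) = 1"
    "CXZ (f j) (h k) = 1" "CYZ (g s) (h k) = 1" "CXZ (f j) (h k') = 1" "CYZ (g s) (h k') = 1"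
    for j s k k'
  proof -
    have "h k = h k'"
      using M fX[OF that(1)] gY[OF that(2)] hZ[OF that(3)] hZ[OF that(4)] that(5-9)
      unfolding pda_matrices_def by blast
    then show ?thesis using bij_betw_imp_inj_on[OF h] that(3,4) by (auto dest: inj_onD)
  qed
  have E4: "\<exists>!s. s \<in> {1..S} \<and> CXY (f j) (g s) = 1 \<and> CYZ (g s) (h k) = 1"
    if "j \<in> {1..F}" "k \<in> {1..K}" "CXZ (f j) (h k) = 1" for j k
  proof -
    have ex1: "\<exists>!y. y \<in> Y \<and> CXY (f j) y = 1 \<and> CYZ y (h k) = 1"
      using M fX[OF that(1)] hZ[OF that(2)] that(3) unfolding pda_matrices_def by blast
    then obtain y where "y \<in> Y" "CXY (f j) y = 1" "CYZ y (h k) = 1" by blast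
    then obtain s where s: "s \<in> {1..S}" "CXY (f j) (g s) = 1" "CYZ (g s) (h k) = 1"
      using bij_betw_imp_surj_on[OF g] by blast
    show ?thesis
    proof (rule ex1I[of _ s])
      fix s' assume s': "s' \<in> {1..S} \<and> CXY (f j) (g s') = 1 \<and> CYZ (g s') (h k) = 1"
      then have "g s' = g s" using ex1 s gY by blast
      then show "s' = s" using bij_betw_imp_inj_on[OF g] s s' by (auto dest: inj_onD)
    qed (use s in blast)
  qed
  have E5: "\<exists>!j. j \<in> {1..F} \<and> CXY (f j) (g s) = 1 \<and> CXZ (f j) (h k) = 1"
    if "s \<in> {1..S}" "k \<in> {1..K}" "CYZ (g s) (h k) = 1" for s k
  proof -
    have ex1: "\<exists>!x. x \<in> X \<and> CXY x (g s) = 1 \<and> CXZ x (h k) = 1"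
      using M gY[OF that(1)] hZ[OF that(2)] that(3) unfolding pda_matrices_def by blast
    then obtain x where "x \<in> X" "CXY x (g s) = 1" "CXZ x (h k) = 1" by blast
    then obtain j where j: "j \<in> {1..F}" "CXY (f j) (g s) = 1" "CXZ (f j) (h k) = 1"
      using bij_betw_imp_surj_on[OF f] by blast
    show ?thesis
    proof (rule ex1I[of _ j])
      fix j' assume j': "j' \<in> {1..F} \<and> CXY (f j') (g s) = 1 \<and> CXZ (f j') (h k) = 1"
      then have "f j' = f j" using ex1 j fX by blast
      then show "j' = j" using bij_betw_imp_inj_on[OF f] j j' by (auto dest: inj_onD)
    qed (use j in blast)
  qed
  define A where "A = ?P"
  have A_None: "A j k = None \<longleftrightarrow> CXZ (f j) (h k) \<noteq> 1" for j k
    by (simp add: A_def)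
  have A_Some: "A j k = Some s \<longleftrightarrow>
      CXZ (f j) (h k) = 1 \<and> s \<in> {1..S} \<and> CXY (f j) (g s) = 1 \<and> CYZ (g s) (h k) = 1"
    if "j \<in> {1..F}" "k \<in> {1..K}" for j k s
  proof (cases "CXZ (f j) (h k) = 1")
    case True
    \<comment> \<open>Unique existence turns the defining property of \<open>s\<close> into equality
      with the described value; from here on the description operator no longer appears.\<close>
    show ?thesis unfolding theI_unique[OF E4[OF that True], of s] using True by (auto simp: A_def)
  qed (simp add: A_def)
  have C0: "A j k \<in> Some ` {1..S} \<union> {None}" if "j \<in> {1..F}" "k \<in> {1..K}" for j k
  proof (cases "A j k")
    case (Some s)
    then show ?thesis using A_Some[OF that, of s] by blast
  qed simp
  have C1: "card {j\<in>{1..F}. A j k = None} = Q" if "k \<in> {1..K}" for k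
  proof -
    have "card {j\<in>{1..F}. CXZ (f j) (h k) = 1} = card {x\<in>X. CXZ x (h k) = 1}"
      by (rule card_Collect_bij_betw[OF f])
    also have "\<dots> = card X - Q" using M hZ[OF that] unfolding pda_matrices_def by blast
    also have "card X = F" using bij_betw_same_card[OF f] by simp
    \<comment> \<open>The stars in the column number \<open>F - (F - Q)\<close>, which is
      \<open>Q\<close> under truncated subtraction because \<open>Q \<le> F\<close>.\<close>
    finally show ?thesis
      using \<open>Q \<le> F\<close> by (simp only: A_None card_Collect_complement[OF finite_atLeastAtMost]) simp
  qed
  have C2: "\<exists>j\<in>{1..F}. \<exists>k\<in>{1..K}. A j k = Some s" if s: "s \<in> {1..S}" for s
  proof -
    obtain z where "z \<in> Z" "CYZ (g s) z = 1" using M gY[OF s] unfolding pda_matrices_def by blast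
    then obtain k where k: "k \<in> {1..K}" "CYZ (g s) (h k) = 1"
      using bij_betw_imp_surj_on[OF h] by blast
    \<comment> \<open>(E2) has given a column for \<open>s\<close>; the existence part of (E5)
      supplies a row whose cell in that column is marked and linked to \<open>s\<close>.\<close>
    then show ?thesis using E5[OF s k] A_Some s by blast
  qed
  have C3: "(j1, k1) = (j2, k2)"
    if "j1 \<in> {1..F}" "k1 \<in> {1..K}" "j2 \<in> {1..F}" "k2 \<in> {1..K}"
      "A j1 k1 = Some s" "A j2 k2 = Some s" "A j1 k2 \<noteq> None" for j1 k1 j2 k2 s
  proof -
    have 1: "CXZ (f j1) (h k1) = 1" "s \<in> {1..S}" "CXY (f j1) (g s) = 1" "CYZ (g s) (h k1) = 1"
      using that(5) A_Some[OF that(1,2)] by blast+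
    have 2: "CXZ (f j2) (h k2) = 1" "CXY (f j2) (g s) = 1" "CYZ (g s) (h k2) = 1"
      using that(6) A_Some[OF that(3,4)] by blast+
    have 3: "CXZ (f j1) (h k2) = 1" using that(7) A_None by simp
    \<comment> \<open>Both columns are marked in row \<open>j1\<close> and linked to
      \<open>s\<close>, so (E3) merges them; then both rows serve \<open>s\<close> in column
      \<open>k2\<close>, and (E5) merges those.\<close>
    have "k1 = k2" using E3[OF that(1) 1(2) that(2,4) 1(3,1,4) 3 2(3)] .
    moreover have "j1 = j2" using E5[OF 1(2) that(4) 2(3)] that(1,3) 1(3) 2 3 by blast
    ultimately show ?thesis by simp
  qed
  have "j1 \<noteq> j2 \<and> k1 \<noteq> k2 \<and> A j1 k2 = None \<and> A j2 k1 = None"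
    if "j1 \<in> {1..F}" "k1 \<in> {1..K}" "j2 \<in> {1..F}" "k2 \<in> {1..K}"
      "A j1 k1 = Some s" "A j2 k2 = Some s" "(j1, k1) \<noteq> (j2, k2)" for j1 k1 j2 k2 s
  proof -
    have "A j1 k2 = None" "A j2 k1 = None"
      using C3[OF that(1-6)] C3[OF that(3,4,1,2,6,5)] that(7) by metis+
    \<comment> \<open>If the rows or the columns agreed, a crossing cell would be an occurrence of
      \<open>s\<close> instead of a star.\<close>
    then show ?thesis using that(5,6) by auto
  qed
  then show ?thesis
    unfolding A_def[symmetric] is_PDA_def using C0 C1 C2 by (intro conjI ballI impI) blast+
qed

theorem theorem1:
  fixes K F Q S :: nat
  assumes "0 < K" and "0 < F" and "0 < Q" and "0 < S" and "Q < F"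
    and "\<exists>X :: 'x set. card X = F"
    and "\<exists>Y :: 'y set. card Y = S"
    and "\<exists>Z :: 'z set. card Z = K"
  shows "(\<exists>P. is_PDA K F Q S P) \<longleftrightarrow>
    (\<exists>(X :: 'x set) (Y :: 'y set) (Z :: 'z set) CXY CXZ CYZ.
       card X = F \<and> card Y = S \<and> card Z = K \<and>
       binary_matrix X Y CXY \<and> binary_matrix X Z CXZ \<and> binary_matrix Y Z CYZ \<and>
       (\<forall>z\<in>Z. card {x\<in>X. CXZ x z = 1} = card X - Q) \<and>
       (\<forall>y\<in>Y. {z\<in>Z. CYZ y z = 1} \<noteq> {}) \<and>
       (\<forall>x\<in>X. \<forall>y\<in>Y. CXY x y = 1 \<longrightarrow> (\<exists>!z. z \<in> Z \<and> CXZ x z = 1 \<and> CYZ y z = 1)) \<and>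
       (\<forall>x\<in>X. \<forall>z\<in>Z. CXZ x z = 1 \<longrightarrow> (\<exists>!y. y \<in> Y \<and> CXY x y = 1 \<and> CYZ y z = 1)) \<and>
       (\<forall>y\<in>Y. \<forall>z\<in>Z. CYZ y z = 1 \<longrightarrow> (\<exists>!x. x \<in> X \<and> CXY x y = 1 \<and> CXZ x z = 1)))"
proof -
  have "(\<exists>P. is_PDA K F Q S P) \<longleftrightarrow>
    (\<exists>(X :: 'x set) (Y :: 'y set) (Z :: 'z set) CXY CXZ CYZ.
       card X = F \<and> card Y = S \<and> card Z = K \<and> pda_matrices X Y Z Q CXY CXZ CYZ)"
  proof
    assume "\<exists>P. is_PDA K F Q S P"
    then obtain P where P: "is_PDA K F Q S P" by blast
    obtain X :: "'x set" and Y :: "'y set" and Z :: "'z set"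
      where c: "card X = F" "card Y = S" "card Z = K" using assms(6-8) by blast
    \<comment> \<open>Infinite sets have \<open>card\<close> equal to 0, so positive cardinalities
      force finiteness and hence numberings starting at 1.\<close>
    then have "finite X" "finite Y" "finite Z" using assms(1,2,4) card_gt_0_iff by blast+
    then obtain f g h where "bij_betw f X {1..F}" "bij_betw g Y {1..S}" "bij_betw h Z {1..K}"
      using c ex_bij_betw_nat_finite_1 bij_betw_inv by metis
    from is_PDA_imp_pda_matrices[OF P this] c
    show "\<exists>(X :: 'x set) (Y :: 'y set) (Z :: 'z set) CXY CXZ CYZ.
       card X = F \<and> card Y = S \<and> card Z = K \<and> pda_matrices X Y Z Q CXY CXZ CYZ" by blast
  next
    assume "\<exists>(X :: 'x set) (Y :: 'y set) (Z :: 'z set) CXY CXZ CYZ.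
       card X = F \<and> card Y = S \<and> card Z = K \<and> pda_matrices X Y Z Q CXY CXZ CYZ"
    then obtain X :: "'x set" and Y :: "'y set" and Z :: "'z set" and CXY CXZ CYZ
      where c: "card X = F" "card Y = S" "card Z = K" and M: "pda_matrices X Y Z Q CXY CXZ CYZ"
      by blast
    from c have "finite X" "finite Y" "finite Z" using assms(1,2,4) card_gt_0_iff by blast+
    then obtain f g h where "bij_betw f {1..F} X" "bij_betw g {1..S} Y" "bij_betw h {1..K} Z"
      using c ex_bij_betw_nat_finite_1 by metis
    from pda_matrices_imp_is_PDA[OF M less_imp_le[OF \<open>Q < F\<close>] this]
    show "\<exists>P. is_PDA K F Q S P" by blast
  qed
  then show ?thesis unfolding pda_matrices_def .
qed

end
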